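(* Let $q$ and $z$ be local dual conformal coordinates related by a holomorphic map $z=z(q)$ with $z_q=\frac{dz}{dq}\neq 0$. Let $H$ be the conformal factor of the $q$-net and let $\omega$ and $\widetilde\omega$ be the complex curvature coefficients of the $q$-net and of the dual $z$-net, respectively. Then $$\frac1H\,\widetilde\omega\,dz-H\,\omega\,dq=2i\,d\log z_q .$$ Moreover, if $\mathcal Z=Tz\circ(Tq)^{-1}$ denotes the relative differential morphism of the two projections $q$ and $z$, the same identity is expressed intrinsically as $$\frac1H\,\widetilde\omega\,dz-H\,\omega\,dq=2i\,\mathcal Z^{-1}d\mathcal Z ,$$ where the right-hand side denotes the local logarithmic Maurer--Cartan form of $\mathcal Z$ (in the coordinate frame $\frac{\partial}{\partial z}\otimes dq$).
   Context: Dual conformal nets: $q=q_1+iq_2$ is a local conformal (holomorphic) coordinate, and $ds^2=H^2(dq_1^2+dq_2^2)$ is a metric with conformal factor $H>0$. The dual conformal coordinate $z=z(q)$ is a holomorphic function of $q$ with $z_q\neq 0$ such that $H=|z_q|$; the dual net (in the coordinate $z$) has conformal factor $\widetilde H=H^{-1}$. Write $\partial_q=\frac12(\partial_{q_1}-i\partial_{q_2})$ and, with $z=z_1+iz_2$, $\partial_z=\frac12(\partial_{z_1}-i\partial_{z_2})=z_q^{-1}\partial_q$. The complex curvature coefficients of the two nets are $$\omega=-\frac{2i}{H}\,\partial_q\log H,\qquad \widetilde\omega=-\frac{2i}{\widetilde H}\,\partial_z\log\widetilde H .$$ The form $d\log z_q$ means $z_q^{-1}dz_q$. Relative differential morphism: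 for two nonconstant meromorphic maps $q,z:X\to\mathbb P^1$ on a Riemann surface, $Tq:TX\to q^*T\mathbb P^1$ and $Tz:TX\to z^*T\mathbb P^1$ are the differentials, and $\mathcal Z=Tz\circ(Tq)^{-1}$, a meromorphic section of $\mathcal H=\operatorname{Hom}(q^*T\mathbb P^1,z^*T\mathbb P^1)$. Given a local frame $E_\alpha$ of $\mathcal H$ with $\mathcal Z=g_\alpha E_\alpha$, the symbol $\mathcal Z^{-1}d\mathcal Z$ denotes the local logarithmic form $g_\alpha^{-1}dg_\alpha$ (the pullback under $g_\alpha$ of the Maurer--Cartan form $g^{-1}dg$ of $\mathbb C^*$). The coordinate frame determined by local coordinates $q,z$ is $\frac{\partial}{\partial z}\otimes dq$. *)

theory Defs
  imports "HOL-Complex_Analysis.Complex_Analysis"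
begin

section \<open>Riemann surfaces\<close>

type_synonym 'a chart = "'a set \<times> ('a \<Rightarrow> complex)"

definition is_chart :: "'a topology \<Rightarrow> 'a chart \<Rightarrow> bool" where
  "is_chart X c \<longleftrightarrow> openin X (fst c) \<and> open (snd c ` fst c) \<and>
     homeomorphic_map (subtopology X (fst c)) (top_of_set (snd c ` fst c)) (snd c)"

abbreviation chart_inv :: "'a chart \<Rightarrow> complex \<Rightarrow> 'a" where
  "chart_inv c \<equiv> inv_into (fst c) (snd c)"

definition transition :: "'a chart \<Rightarrow> 'a chart \<Rightarrow> complex \<Rightarrow> complex" where
  "transition c d = snd d \<circ> chart_inv c"

definition compatible :: "'a chart \<Rightarrow> 'a chart \<Rightarrow> bool" where
  "compatible c d \<longleftrightarrow>
     transition c d holomorphic_on (snd c ` (fst c \<inter> fst d)) \<and>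
     transition d c holomorphic_on (snd d ` (fst c \<inter> fst d))"

definition riemann_surface :: "'a topology \<Rightarrow> 'a chart set \<Rightarrow> bool" where
  "riemann_surface X A \<longleftrightarrow> Hausdorff_space X \<and> connected_space X \<and>
     (\<forall>c\<in>A. is_chart X c) \<and> \<Union> (fst ` A) = topspace X \<and>
     (\<forall>c\<in>A. \<forall>d\<in>A. compatible c d)"

text \<open>Local holomorphic coordinates: the members of the maximal atlas generated by \<open>A\<close>.\<close>

definition local_coordinate :: "'a topology \<Rightarrow> 'a chart set \<Rightarrow> 'a chart \<Rightarrow> bool" where
  "local_coordinate X A c \<longleftrightarrow> is_chart X c \<and> (\<forall>d\<in>A. compatible c d)"

definition holomorphic_map ::
  "'a topology \<Rightarrow> 'a chart set \<Rightarrow> 'b topology \<Rightarrow> 'b chart set \<Rightarrow> ('a \<Rightarrow> 'b) \<Rightarrow> bool" where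
  "holomorphic_map X A Y B f \<longleftrightarrow> continuous_map X Y f \<and>
     (\<forall>c\<in>A. \<forall>d\<in>B. (snd d \<circ> f \<circ> chart_inv c) holomorphic_on (snd c ` {x \<in> fst c. f x \<in> fst d}))"

section \<open>Tangent vectors\<close>

text \<open>
  A tangent vector at \<open>p\<close> is the family of its components in the charts of the atlas around \<open>p\<close>;
  the components in two charts differ by the derivative of the transition map.  The component in a
  chart that does not contain \<open>p\<close> is set to 0, so that a tangent vector is determined by its
  components.
\<close>

type_synonym 'a tangent = "'a chart \<Rightarrow> complex"

definition charts_at :: "'a chart set \<Rightarrow> 'a \<Rightarrow> 'a chart set" where
  "charts_at A p = {c \<in> A. p \<in> fst c}"

definition tangent_space :: "'a chart set \<Rightarrow> 'a \<Rightarrow> 'a tangent set" where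
  "tangent_space A p =
     {v. (\<forall>c\<in>charts_at A p. \<forall>d\<in>charts_at A p. v d = deriv (transition c d) (snd c p) * v c) \<and>
         (\<forall>c. c \<notin> charts_at A p \<longrightarrow> v c = 0)}"

text \<open>
  In the next two definitions \<open>c\<close> is an arbitrary chart around \<open>p\<close>; by the chain rule the
  values do not depend on it.
\<close>

definition tangent_map ::
  "'a chart set \<Rightarrow> 'b chart set \<Rightarrow> ('a \<Rightarrow> 'b) \<Rightarrow> 'a \<Rightarrow> 'a tangent \<Rightarrow> 'b tangent" where
  "tangent_map A B f p v = (\<lambda>d.
     if d \<in> charts_at B (f p)
     then let c = (SOME c. c \<in> charts_at A p)
          in deriv (snd d \<circ> f \<circ> chart_inv c) (snd c p) * v c
     else 0)"

text \<open>
  The exterior derivative \<open>df\<close> of a (real-differentiable) complex-valued function, evaluated at the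
  tangent vector \<open>v\<close> at \<open>p\<close>.  Identities between 1-forms are stated as identities of their values
  on all tangent vectors.
\<close>

definition differential :: "'a chart set \<Rightarrow> ('a \<Rightarrow> complex) \<Rightarrow> 'a \<Rightarrow> 'a tangent \<Rightarrow> complex" where
  "differential A f p v =
     (let c = (SOME c. c \<in> charts_at A p)
      in frechet_derivative (f \<circ> chart_inv c) (at (snd c p)) (v c))"

definition log_differential :: "'a chart set \<Rightarrow> ('a \<Rightarrow> complex) \<Rightarrow> 'a \<Rightarrow> 'a tangent \<Rightarrow> complex" where
  "log_differential A f p v = inverse (f p) * differential A f p v"

definition coordinate_vector :: "'a chart set \<Rightarrow> 'a chart \<Rightarrow> 'a \<Rightarrow> 'a tangent" where
  "coordinate_vector A d p =
     (\<lambda>e. if e \<in> charts_at A p then deriv (transition d e) (snd d p) else 0)"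

section \<open>The projective line\<close>

text \<open>\<open>None\<close> is the point at infinity.\<close>

definition P1_top :: "complex option topology" where
  "P1_top = Alexandroff_compactification euclidean"

definition affine_chart :: "complex option chart" where
  "affine_chart = (range Some, the)"

definition infinity_chart :: "complex option chart" where
  "infinity_chart = (- {Some 0}, \<lambda>x. case x of None \<Rightarrow> 0 | Some w \<Rightarrow> inverse w)"

definition P1_atlas :: "complex option chart set" where
  "P1_atlas = {affine_chart, infinity_chart}"

definition nonconstant_meromorphic ::
  "'a topology \<Rightarrow> 'a chart set \<Rightarrow> ('a \<Rightarrow> complex option) \<Rightarrow> bool" where
  "nonconstant_meromorphic X A f \<longleftrightarrow> holomorphic_map X A P1_top P1_atlas f \<and>
     \<not> (\<exists>y. \<forall>p\<in>topspace X. f p = y)"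

section \<open>Conformal nets\<close>

text \<open>The Wirtinger derivative \<open>(\<partial>\<^sub>1 - i \<partial>\<^sub>2) / 2\<close>.\<close>

definition wirtinger :: "(complex \<Rightarrow> complex) \<Rightarrow> complex \<Rightarrow> complex" where
  "wirtinger f w =
     (frechet_derivative f (at w) 1 - \<i> * frechet_derivative f (at w) \<i>) / 2"

text \<open>
  The net is given by a coordinate \<open>c\<close> and the conformal factor \<open>H\<close> of the metric \<open>H\<^sup>2 |dc|\<^sup>2\<close>;
  \<open>H\<close> is a function on the surface and is differentiated with respect to the coordinate \<open>c\<close>.
\<close>

definition complex_curvature :: "'a chart \<Rightarrow> ('a \<Rightarrow> real) \<Rightarrow> 'a \<Rightarrow> complex" where
  "complex_curvature c H p =
     - (2 * \<i> / of_real (H p)) * wirtinger (\<lambda>w. of_real (ln (H (chart_inv c w)))) (snd c p)"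

section \<open>The relative differential morphism\<close>

text \<open>
  The morphism \<open>Tz \<circ> (Tq)\<^sup>-\<^sup>1\<close> at a point \<open>p\<close> maps the tangent space of the projective line at
  \<open>q p\<close> to the one at \<open>z p\<close>; it is meaningful at the points where \<open>Tq\<close> is invertible.
\<close>

definition relative_differential ::
  "'a chart set \<Rightarrow> ('a \<Rightarrow> complex option) \<Rightarrow> ('a \<Rightarrow> complex option) \<Rightarrow>
   'a \<Rightarrow> complex option tangent \<Rightarrow> complex option tangent" where
  "relative_differential A q z p =
     tangent_map A P1_atlas z p \<circ> inv_into (tangent_space A p) (tangent_map A P1_atlas q p)"

text \<open>The frame \<open>\<partial>/\<partial>z \<otimes> dq\<close> determined by the affine coordinates on source and target.\<close>

definition coordinate_frame ::
  "('a \<Rightarrow> complex option) \<Rightarrow> 'a \<Rightarrow> complex option tangent \<Rightarrow> complex option tangent" where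
  "coordinate_frame z p w =
     (\<lambda>e. w affine_chart * coordinate_vector P1_atlas affine_chart (z p) e)"

text \<open>
  The coefficient \<open>g\<close> in \<open>Z = g E\<close> for sections \<open>Z\<close>, \<open>E\<close> of the bundle of homomorphisms from
  \<open>q\<^sup>*TP\<^sup>1\<close>, and the local Maurer--Cartan form \<open>g\<^sup>-\<^sup>1 dg\<close>.
\<close>

definition frame_coefficient ::
  "('a \<Rightarrow> complex option) \<Rightarrow>
   ('a \<Rightarrow> complex option tangent \<Rightarrow> complex option tangent) \<Rightarrow>
   ('a \<Rightarrow> complex option tangent \<Rightarrow> complex option tangent) \<Rightarrow> 'a \<Rightarrow> complex" where
  "frame_coefficient q Z E p =
     (THE g. \<forall>w\<in>tangent_space P1_atlas (q p). Z p w = (\<lambda>e. g * E p w e))"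

definition maurer_cartan_form ::
  "'a chart set \<Rightarrow> ('a \<Rightarrow> complex option) \<Rightarrow>
   ('a \<Rightarrow> complex option tangent \<Rightarrow> complex option tangent) \<Rightarrow>
   ('a \<Rightarrow> complex option tangent \<Rightarrow> complex option tangent) \<Rightarrow>
   'a \<Rightarrow> 'a tangent \<Rightarrow> complex" where
  "maurer_cartan_form A q Z E = log_differential A (frame_coefficient q Z E)"

end

theory Submission
  imports Defs
begin

text \<open>
  In the coordinate \<open>q\<close> the conformal factor is \<open>|\<zeta>'(q)|\<close>; in the coordinate \<open>z\<close> its inverse is
  \<open>|1 / \<zeta>'(\<eta>(z))|\<close>, where \<open>\<eta>\<close> is the inverse of \<open>\<zeta>\<close>, which is injective on
  \<open>q ` U\<close> because \<open>z\<close> is a chart.  Both are absolute values of nowhere vanishing holomorphic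
  functions \<open>f\<close>, and \<open>ln |f|\<close> is the real part of a local branch of the
  holomorphic function \<open>log f\<close>, so its Wirtinger derivative is \<open>f' / (2 f)\<close>
  (\<open>complex_curvature_holomorphic_factor\<close>).  This gives
  \<open>H \<omega> = - \<i> \<zeta>'' / \<zeta>'\<close> and \<open>\<omega>' / H = \<i> \<zeta>'' / \<zeta>'\<^sup>2\<close>.  As \<open>dz = \<zeta>' dq\<close>, each of the terms
  \<open>\<omega>' dz / H\<close> and \<open>- H \<omega> dq\<close> contributes one half of \<open>2 \<i> (\<zeta>'' / \<zeta>') dq = 2 \<i> d log \<zeta>'\<close>.

  For the intrinsic form it suffices that the coefficient of the relative differential in the
  coordinate frame is \<open>\<zeta>'(q)\<close> on all of \<open>U\<close>
  (\<open>frame_coefficient_relative_differential\<close>).  All tangent spaces involved are complex lines, and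
  \<open>Tq\<close> and \<open>Tz\<close> multiply by \<open>q'\<close> and \<open>\<zeta>' q'\<close> with respect to a chart of the atlas and the affine
  chart of the projective line.  The quotient is \<open>\<zeta>'\<close>; it exists because \<open>q' \<noteq> 0\<close>, a change of
  charts being injective and holomorphic.

  The definitions evaluate forms and tangent maps in one chosen chart of the atlas, while the
  functions are given in terms of the coordinate \<open>q\<close>.  The passage from one to the other is always
  the chain rule in the form \<open>has_field_derivative_in_chart\<close>.
\<close>

section \<open>Charts and the chain rule\<close>

lemma is_chart_inj_on:
  assumes "is_chart X c"
  shows "inj_on (snd c) (fst c)"
  using assms homeomorphic_imp_injective_map[of "subtopology X (fst c)" _ "snd c"]
  by (auto simp: is_chart_def topspace_subtopology Int_absorb1 dest: openin_subset)

lemma chart_inv_chart: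
  assumes "is_chart X c" "r \<in> fst c"
  shows "chart_inv c (snd c r) = r"
  using is_chart_inj_on[OF assms(1)] assms(2) by simp

lemma is_chart_open_image:
  assumes "is_chart X c" "openin X V" "V \<subseteq> fst c"
  shows "open (snd c ` V)"
proof -
  have "openin (subtopology X (fst c)) V"
    unfolding openin_subtopology using assms by blast
  then have "openin (top_of_set (snd c ` fst c)) (snd c ` V)"
    using assms(1) homeomorphic_imp_open_map unfolding is_chart_def open_map_def by blast
  then show ?thesis
    using assms(1) unfolding is_chart_def by (metis openin_open_trans)
qed

lemma charts_atD:
  assumes "riemann_surface X A" "c \<in> charts_at A p"
  shows "c \<in> A" "p \<in> fst c" "is_chart X c" "local_coordinate X A c"
  using assms by (simp_all add: charts_at_def riemann_surface_def local_coordinate_def)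

lemma open_image_chart_overlap:
  assumes "is_chart X c" "is_chart X d"
  shows "open (snd c ` (fst c \<inter> fst d))"
  using assms by (intro is_chart_open_image) (auto simp: is_chart_def)

text \<open>The chart in which \<^const>\<open>differential\<close> and \<^const>\<open>tangent_map\<close> are evaluated.\<close>

definition chosen_chart :: "'a chart set \<Rightarrow> 'a \<Rightarrow> 'a chart" where
  "chosen_chart A p = (SOME c. c \<in> charts_at A p)"

lemma chosen_chart_in_charts_at:
  assumes "riemann_surface X A" "local_coordinate X A d" "p \<in> fst d"
  shows "chosen_chart A p \<in> charts_at A p"
proof -
  have "p \<in> topspace X"
    using assms(2,3) by (auto simp: local_coordinate_def is_chart_def dest: openin_subset)
  then have "\<exists>c. c \<in> charts_at A p"
    using assms(1) unfolding riemann_surface_def charts_at_def by blast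
  then show ?thesis
    unfolding chosen_chart_def by (rule someI_ex)
qed

lemma transition_holomorphic:
  assumes "riemann_surface X A" "local_coordinate X A d" "c \<in> A"
  shows "transition c d holomorphic_on snd c ` (fst c \<inter> fst d)"
  using assms by (auto simp: local_coordinate_def compatible_def Int_commute)

text \<open>Injective holomorphic functions have no critical points.\<close>

lemma transition_deriv_nonzero:
  assumes "riemann_surface X A" "local_coordinate X A d" "c \<in> charts_at A p" "p \<in> fst d"
  shows "deriv (transition c d) (snd c p) \<noteq> 0"
proof (rule holomorphic_injective_imp_regular)
  note c = charts_atD[OF assms(1,3)]
  have d: "is_chart X d"
    using assms(2) by (simp add: local_coordinate_def)
  show "transition c d holomorphic_on snd c ` (fst c \<inter> fst d)"
    using transition_holomorphic assms(1,2) c(1) by blast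
  show "open (snd c ` (fst c \<inter> fst d))"
    using open_image_chart_overlap c d by blast
  show "inj_on (transition c d) (snd c ` (fst c \<inter> fst d))"
    using is_chart_inj_on[OF d]
    by (auto simp: inj_on_def transition_def chart_inv_chart[OF c(3)])
  show "snd c p \<in> snd c ` (fst c \<inter> fst d)"
    using c assms(4) by blast
qed

text \<open>
  A function is often known only as a function of some coordinate \<open>d\<close> that is not in the atlas,
  and only on the domain of \<open>d\<close>.  This is enough to differentiate it in a chart \<open>c\<close> of the atlas,
  since the overlap of the two charts is a neighbourhood of \<open>p\<close>.
\<close>

lemma has_field_derivative_in_chart:
  assumes rs: "riemann_surface X A" and d: "local_coordinate X A d"
    and c: "c \<in> charts_at A p" and p: "p \<in> fst d"
    and f: "\<And>r. r \<in> fst d \<Longrightarrow> f r = F (snd d r)"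
    and F: "(F has_field_derivative D) (at (snd d p))"
  shows "(f \<circ> chart_inv c has_field_derivative D * deriv (transition c d) (snd c p)) (at (snd c p))"
proof -
  note c' = charts_atD[OF rs c]
  define W where "W = snd c ` (fst c \<inter> fst d)"
  have W: "open W" "snd c p \<in> W"
    using open_image_chart_overlap[of X c d] c' d p by (auto simp: W_def local_coordinate_def)
  have "transition c d holomorphic_on W"
    using transition_holomorphic rs d c'(1) unfolding W_def by blast
  then have "(transition c d has_field_derivative deriv (transition c d) (snd c p)) (at (snd c p))"
    using W by (rule holomorphic_derivI)
  moreover have "transition c d (snd c p) = snd d p"
    by (simp add: transition_def chart_inv_chart[OF c'(3,2)])
  ultimately have
    "(F \<circ> transition c d has_field_derivative D * deriv (transition c d) (snd c p)) (at (snd c p))"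
    using F by (intro DERIV_chain) auto
  then show ?thesis
    using W
  proof (rule has_field_derivative_transform_within_open)
    fix x assume "x \<in> W"
    then show "(F \<circ> transition c d) x = (f \<circ> chart_inv c) x"
      by (auto simp: W_def transition_def chart_inv_chart[OF c'(3)] f)
  qed
qed

text \<open>
  The chain rule \<open>df = F'(d) dd\<close>: both differentials carry the same factor from the chosen chart
  to the coordinate \<open>d\<close>.
\<close>

lemma differential_eq:
  assumes "riemann_surface X A" "local_coordinate X A d" "p \<in> fst d"
    and "\<And>r. r \<in> fst d \<Longrightarrow> f r = F (snd d r)"
    and "(F has_field_derivative D) (at (snd d p))"
  shows "differential A f p v = D * differential A (snd d) p v"
proof -
  let ?c = "chosen_chart A p"
  let ?t = "deriv (transition ?c d) (snd ?c p)"
  have *: "differential A g p v = G' * ?t * v ?c"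
    if "\<And>r. r \<in> fst d \<Longrightarrow> g r = G (snd d r)" "(G has_field_derivative G') (at (snd d p))"
    for g G G'
  proof -
    have "(g \<circ> chart_inv ?c has_field_derivative G' * ?t) (at (snd ?c p))"
      using that assms(1-3) chosen_chart_in_charts_at[OF assms(1-3)]
      by (intro has_field_derivative_in_chart[of X A d ?c p g G G'])
    then have "frechet_derivative (g \<circ> chart_inv ?c) (at (snd ?c p)) = (*) (G' * ?t)"
      using frechet_derivative_at unfolding has_field_derivative_def by metis
    then show ?thesis
      by (simp add: differential_def chosen_chart_def Let_def)
  qed
  have "differential A (snd d) p v = 1 * ?t * v ?c"
    by (rule *[where G = "\<lambda>x. x"]) auto
  then show ?thesis
    using *[OF assms(4,5)] by simp
qed

section \<open>The curvature coefficient of a holomorphic conformal factor\<close>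

text \<open>
  The derivative of \<open>ln |f| = Re (log f)\<close>, computed from the norm directly so that no branch of
  the logarithm has to be chosen.
\<close>

lemma has_derivative_ln_cmod:
  assumes "(f has_field_derivative D) (at w)" "f w \<noteq> 0"
  shows "((\<lambda>x. complex_of_real (ln (cmod (f x)))) has_derivative
           (\<lambda>h. complex_of_real (Re (D / f w * h)))) (at w)"
proof -
  have 1: "(f has_derivative (*) D) (at w)"
    using assms(1) by (simp add: has_field_derivative_def)
  have 2: "((\<lambda>x. norm (f x)) has_derivative (\<lambda>h. inner (D * h) (sgn (f w)))) (at w)"
    using has_derivative_compose[OF 1 has_derivative_norm[OF assms(2)]] by simp
  have 3: "(ln has_real_derivative inverse (cmod (f w))) (at (cmod (f w)))"
    using assms(2) by (intro DERIV_ln) auto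
  have "((\<lambda>x. ln (cmod (f x))) has_derivative
      (\<lambda>h. inverse (cmod (f w)) * inner (D * h) (sgn (f w)))) (at w)"
    using has_derivative_compose[OF 2 3[unfolded has_field_derivative_def]] by simp
  moreover have "inverse (cmod (f w)) * inner (D * h) (sgn (f w)) = Re (D / f w * h)" for h
  proof -
    have "D / f w * h = D * h * cnj (f w) / complex_of_real ((cmod (f w))\<^sup>2)"
      using complex_div_cnj[of "D * h" "f w"] by simp
    then have "Re (D / f w * h) = Re (D * h * cnj (f w)) / (cmod (f w))\<^sup>2"
      by (metis Re_divide_of_real)
    moreover have "inner (D * h) (f w) = Re (D * h * cnj (f w))"
      by (simp only: inner_complex_def complex_cnj complex.sel times_complex.sel) simp
    ultimately show ?thesis
      by (simp add: sgn_div_norm power2_eq_square divide_inverse)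
  qed
  ultimately have "((\<lambda>x. ln (cmod (f x))) has_derivative (\<lambda>h. Re (D / f w * h))) (at w)"
    by (simp only:)
  then show ?thesis
    by (rule has_derivative_of_real)
qed

text \<open>
  The Wirtinger derivative of the real part of a holomorphic function is half of its complex
  derivative, because the antiholomorphic half of the real part is annihilated.  The factor
  \<open>1/2\<close> cancels the 2 in the definition of the curvature coefficient.
\<close>

lemma complex_curvature_holomorphic_factor:
  assumes c: "is_chart X c" "p \<in> fst c"
    and K: "\<And>r. r \<in> fst c \<Longrightarrow> K r = cmod (f (snd c r))"
    and f: "(f has_field_derivative D) (at (snd c p))" "f (snd c p) \<noteq> 0"
  shows "complex_curvature c K p = - (\<i> / of_real (K p)) * (D / f (snd c p))"
proof -
  let ?a = "D / f (snd c p)"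
  let ?L = "\<lambda>w. complex_of_real (ln (K (chart_inv c w)))"
  have "(?L has_derivative (\<lambda>h. complex_of_real (Re (?a * h)))) (at (snd c p))"
  proof (rule has_derivative_transform_within_open[OF has_derivative_ln_cmod[OF f]])
    show "open (snd c ` fst c)" "snd c p \<in> snd c ` fst c"
      using c by (auto simp: is_chart_def)
  qed (auto simp: K chart_inv_chart[OF c(1)])
  then have "frechet_derivative ?L (at (snd c p)) = (\<lambda>h. complex_of_real (Re (?a * h)))"
    by (rule frechet_derivative_at[symmetric])
  then have "wirtinger ?L (snd c p) = (of_real (Re ?a) + \<i> * of_real (Im ?a)) / 2"
    by (simp only: wirtinger_def mult_1_right mult.commute[of _ \<i>] Re_i_times of_real_minus) simp
  also have "\<dots> = ?a / 2"
    by (simp only: complex_eq[symmetric])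
  finally show ?thesis
    by (simp only: complex_curvature_def) simp
qed

section \<open>The relative differential in the coordinate frame\<close>

text \<open>
  The compatibility of the components is the chain rule for three charts.  This provides a nonzero
  vector in every tangent space of the surface.
\<close>

lemma coordinate_vector_in_tangent_space:
  assumes rs: "riemann_surface X A" and c: "c \<in> charts_at A p"
  shows "coordinate_vector A c p \<in> tangent_space A p"
proof -
  have "coordinate_vector A c p e =
      deriv (transition d e) (snd d p) * coordinate_vector A c p d"
    if d: "d \<in> charts_at A p" and e: "e \<in> charts_at A p" for d e
  proof -
    note d' = charts_atD[OF rs d] and e' = charts_atD[OF rs e]
    have "(transition d e has_field_derivative deriv (transition d e) (snd d p)) (at (snd d p))"
      using transition_holomorphic[OF rs e'(4) d'(1)] open_image_chart_overlap[OF d'(3) e'(3)] d' e'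
      by (intro holomorphic_derivI) auto
    then have "(snd e \<circ> chart_inv c has_field_derivative
        deriv (transition d e) (snd d p) * deriv (transition c d) (snd c p)) (at (snd c p))"
      using rs d' c
      by (intro has_field_derivative_in_chart)
        (auto simp: transition_def chart_inv_chart[OF d'(3)])
    then show ?thesis
      using d e by (simp add: coordinate_vector_def transition_def[of c e] DERIV_imp_deriv)
  qed
  moreover have "coordinate_vector A c p e = 0" if "e \<notin> charts_at A p" for e
    using that by (simp add: coordinate_vector_def)
  ultimately show ?thesis
    unfolding tangent_space_def by blast
qed

lemma coordinate_vector_self:
  assumes "is_chart X c" "c \<in> charts_at A p"
  shows "coordinate_vector A c p c = 1"
proof -
  have "(transition c c has_field_derivative 1) (at (snd c p))"
  proof (rule has_field_derivative_transform_within_open[OF DERIV_ident])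
    show "open (snd c ` fst c)" "snd c p \<in> snd c ` fst c"
      using assms by (auto simp: is_chart_def charts_at_def)
  qed (auto simp: transition_def chart_inv_chart[OF assms(1)])
  then show ?thesis
    using assms(2) by (simp add: coordinate_vector_def DERIV_imp_deriv)
qed

lemma tangent_space_scale:
  "v \<in> tangent_space A p \<Longrightarrow> (\<lambda>e. s * v e) \<in> tangent_space A p"
  unfolding tangent_space_def mem_Collect_eq by (metis mult.left_commute mult_zero_right)

lemma affine_chart_inv: "chart_inv affine_chart = Some"
proof
  fix w
  have "chart_inv affine_chart (the (Some w)) = Some w"
    unfolding affine_chart_def fst_conv snd_conv by (rule inv_into_f_f) (auto simp: inj_on_def)
  then show "chart_inv affine_chart w = Some w"
    by simp
qed

lemma infinity_chart_inv:
  assumes "w \<noteq> 0"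
  shows "chart_inv infinity_chart w = Some (inverse w)"
proof -
  have "inj_on (snd infinity_chart) (fst infinity_chart)"
    by (auto simp: infinity_chart_def inj_on_def split: option.splits)
  moreover have "Some (inverse w) \<in> fst infinity_chart"
    "snd infinity_chart (Some (inverse w)) = w"
    using assms by (auto simp: infinity_chart_def)
  ultimately show ?thesis
    by (metis inv_into_f_f)
qed

lemma affine_chart_in_charts_at: "affine_chart \<in> charts_at P1_atlas (Some a)"
  by (auto simp: charts_at_def P1_atlas_def affine_chart_def)

lemma in_charts_at_P1:
  "e \<in> charts_at P1_atlas (Some a) \<longleftrightarrow> e = affine_chart \<or> (e = infinity_chart \<and> a \<noteq> 0)"
  by (auto simp: charts_at_def P1_atlas_def affine_chart_def infinity_chart_def)

lemma transition_affine_affine: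
  "(transition affine_chart affine_chart has_field_derivative 1) (at a)"
proof -
  have "transition affine_chart affine_chart = (\<lambda>x. x)"
    unfolding transition_def affine_chart_inv by (auto simp: affine_chart_def)
  then show ?thesis
    by simp
qed

lemma transition_affine_infinity:
  assumes "a \<noteq> 0"
  shows "(transition affine_chart infinity_chart has_field_derivative - (inverse a ^ 2)) (at a)"
proof -
  have "transition affine_chart infinity_chart = inverse"
    by (auto simp: transition_def affine_chart_inv infinity_chart_def)
  then show ?thesis
    using DERIV_inverse[OF assms, of UNIV] by (simp add: numeral_2_eq_2)
qed

lemma transition_infinity_affine:
  assumes "a \<noteq> 0"
  shows "(transition infinity_chart affine_chart has_field_derivative - (inverse a ^ 2)) (at a)"
  using DERIV_inverse[OF assms, of UNIV, unfolded numeral_2_eq_2[symmetric]]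
proof (rule has_field_derivative_transform_within_open)
  show "open (- {0::complex})" "a \<in> - {0}"
    using assms by auto
qed (auto simp: transition_def infinity_chart_inv affine_chart_def)

lemma transition_infinity_infinity:
  assumes "a \<noteq> 0"
  shows "(transition infinity_chart infinity_chart has_field_derivative 1) (at a)"
proof (rule has_field_derivative_transform_within_open[OF DERIV_ident])
  show "open (- {0::complex})" "a \<in> - {0}"
    using assms by auto
next
  fix x :: complex
  assume "x \<in> - {0}"
  then have "transition infinity_chart infinity_chart x = snd infinity_chart (Some (inverse x))"
    by (simp add: transition_def infinity_chart_inv)
  then show "x = transition infinity_chart infinity_chart x"
    by (simp add: infinity_chart_def)
qed

lemma P1_coordinate_vector_simps:
  "coordinate_vector P1_atlas affine_chart (Some a) affine_chart = 1"
  "a \<noteq> 0 \<Longrightarrow> coordinate_vector P1_atlas affine_chart (Some a) infinity_chart = - (inverse a ^ 2)"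
  using DERIV_imp_deriv[OF transition_affine_affine]
    DERIV_imp_deriv[OF transition_affine_infinity, of a]
  by (auto simp: coordinate_vector_def in_charts_at_P1)
    (auto simp: affine_chart_def)

text \<open>
  The atlas of the projective line has only two charts, and its transition maps are known
  explicitly, so the compatibility of the components can be checked case by case.
\<close>

lemma P1_coordinate_vector_in_tangent_space:
  "coordinate_vector P1_atlas affine_chart (Some a) \<in> tangent_space P1_atlas (Some a)"
proof -
  let ?V = "coordinate_vector P1_atlas affine_chart (Some a)"
  have snd_eq: "snd affine_chart (Some a) = a" "snd infinity_chart (Some a) = inverse a"
    by (auto simp: affine_chart_def infinity_chart_def)
  have "?V e = deriv (transition d e) (snd d (Some a)) * ?V d"
    if "d \<in> charts_at P1_atlas (Some a)" "e \<in> charts_at P1_atlas (Some a)" for d e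
    using that DERIV_imp_deriv[OF transition_affine_affine, of a]
      DERIV_imp_deriv[OF transition_affine_infinity, of a]
      DERIV_imp_deriv[OF transition_infinity_affine, of "inverse a"]
      DERIV_imp_deriv[OF transition_infinity_infinity, of "inverse a"]
    by (auto simp: in_charts_at_P1 snd_eq P1_coordinate_vector_simps field_simps)
  moreover have "?V e = 0" if "e \<notin> charts_at P1_atlas (Some a)" for e
    using that by (simp add: coordinate_vector_def)
  ultimately show ?thesis
    unfolding tangent_space_def by blast
qed

text \<open>
  A tangent vector of the projective line at a finite point is determined by its affine component.
\<close>

lemma P1_tangent_vector_eq:
  assumes "w \<in> tangent_space P1_atlas (Some a)"
  shows "w = (\<lambda>e. w affine_chart * coordinate_vector P1_atlas affine_chart (Some a) e)"
proof
  fix e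
  show "w e = w affine_chart * coordinate_vector P1_atlas affine_chart (Some a) e"
  proof (cases "e \<in> charts_at P1_atlas (Some a)")
    case True
    then have "w e = deriv (transition affine_chart e) (snd affine_chart (Some a)) * w affine_chart"
      using assms affine_chart_in_charts_at unfolding tangent_space_def by blast
    then show ?thesis
      using True by (simp add: coordinate_vector_def)
  next
    case False
    then have "w e = 0"
      using assms unfolding tangent_space_def by blast
    then show ?thesis
      using False by (simp add: coordinate_vector_def)
  qed
qed

text \<open>
  For a map that misses infinity, the components of the image in both charts of the projective
  line come from the affine one.  Thus the tangent map is multiplication by a complex number.
\<close>

lemma tangent_map_P1:
  assumes rs: "riemann_surface X A" and d: "local_coordinate X A d" and p: "p \<in> fst d"
    and f: "\<And>r. r \<in> fst d \<Longrightarrow> f r = Some (F (snd d r))"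
    and F: "(F has_field_derivative D) (at (snd d p))"
  defines "c \<equiv> chosen_chart A p"
  shows "tangent_map A P1_atlas f p v =
    (\<lambda>e. D * deriv (transition c d) (snd c p) * v c *
          coordinate_vector P1_atlas affine_chart (f p) e)"
proof
  fix e
  let ?a = "F (snd d p)"
  let ?t = "deriv (transition c d) (snd c p)"
  let ?G = "transition affine_chart e"
  show "tangent_map A P1_atlas f p v e =
      D * ?t * v c * coordinate_vector P1_atlas affine_chart (f p) e"
  proof (cases "e \<in> charts_at P1_atlas (f p)")
    case True
    then have "e = affine_chart \<or> (e = infinity_chart \<and> ?a \<noteq> 0)"
      using f[OF p] by (simp add: in_charts_at_P1)
    then have "?G field_differentiable at ?a"
      using transition_affine_affine transition_affine_infinity
      unfolding field_differentiable_def by blast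
    then have "(?G has_field_derivative deriv ?G ?a) (at ?a)"
      using DERIV_deriv_iff_field_differentiable by blast
    then have "(?G \<circ> F has_field_derivative deriv ?G ?a * D) (at (snd d p))"
      using F by (intro DERIV_chain) auto
    then have "((snd e \<circ> f) \<circ> chart_inv c has_field_derivative deriv ?G ?a * D * ?t) (at (snd c p))"
      using chosen_chart_in_charts_at[OF rs d p] unfolding c_def
      by (intro has_field_derivative_in_chart[OF rs d _ p, where F = "?G \<circ> F"])
        (auto simp: f transition_def affine_chart_inv)
    then have "deriv (snd e \<circ> f \<circ> chart_inv c) (snd c p) = deriv ?G ?a * D * ?t"
      by (rule DERIV_imp_deriv)
    moreover have "snd affine_chart (f p) = ?a"
      by (simp add: f[OF p] affine_chart_def)
    ultimately show ?thesis
      using True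
      by (simp add: tangent_map_def coordinate_vector_def Let_def c_def chosen_chart_def)
  next
    case False
    then show ?thesis
      by (simp add: tangent_map_def coordinate_vector_def)
  qed
qed

text \<open>
  \<open>Tz\<close> is \<open>D\<close> times \<open>Tq\<close> in the affine components, whatever preimage under \<open>Tq\<close> is taken; and
  preimages exist because \<open>Tq\<close> is a nonzero linear map between complex lines.
\<close>

lemma frame_coefficient_relative_differential:
  assumes rs: "riemann_surface X A" and d: "local_coordinate X A d" and p: "p \<in> fst d"
    and Q: "\<And>r. r \<in> fst d \<Longrightarrow> Q r = Some (snd d r)"
    and Z: "\<And>r. r \<in> fst d \<Longrightarrow> Z r = Some (F (snd d r))"
    and F: "(F has_field_derivative D) (at (snd d p))"
  shows "frame_coefficient Q (relative_differential A Q Z) (coordinate_frame Z) p = D"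
proof -
  define c where "c = chosen_chart A p"
  define t where "t = deriv (transition c d) (snd c p)"
  let ?V = "coordinate_vector P1_atlas affine_chart"
  let ?TQ = "tangent_map A P1_atlas Q p"
  let ?R = "relative_differential A Q Z p"
  have c: "c \<in> charts_at A p"
    using chosen_chart_in_charts_at[OF rs d p] by (simp add: c_def)
  note c_chart = charts_atD(3)[OF rs c]
  have "t \<noteq> 0"
    using transition_deriv_nonzero[OF rs d c p] by (simp add: t_def)
  have TQ: "?TQ v = (\<lambda>e. t * v c * ?V (Q p) e)" for v
    using tangent_map_P1[OF rs d p, where f = Q and F = "\<lambda>x. x" and D = 1 and v = v] Q
    by (simp add: c_def t_def)
  have TZ: "tangent_map A P1_atlas Z p v = (\<lambda>e. D * t * v c * ?V (Z p) e)" for v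
    using tangent_map_P1[OF rs d p Z F] by (simp add: c_def t_def)
  \<comment> \<open>The rescaled coordinate vector of \<open>c\<close> is a preimage of \<open>w\<close> under \<open>Tq\<close>.\<close>
  have R: "?R w = (\<lambda>e. D * coordinate_frame Z p w e)"
    if w: "w \<in> tangent_space P1_atlas (Q p)" for w
  proof -
    let ?u = "\<lambda>e. w affine_chart / t * coordinate_vector A c p e"
    have "?u \<in> tangent_space A p"
      using coordinate_vector_in_tangent_space[OF rs c] by (rule tangent_space_scale)
    moreover have "?TQ ?u = w"
      using P1_tangent_vector_eq[of w "snd d p"] w Q[OF p] \<open>t \<noteq> 0\<close>
      by (simp add: TQ coordinate_vector_self[OF c_chart c])
    ultimately have "w \<in> ?TQ ` tangent_space A p"
      by (metis imageI)
    then have "?TQ (inv_into (tangent_space A p) ?TQ w) affine_chart = w affine_chart"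
      by (simp only: f_inv_into_f)
    then have "t * inv_into (tangent_space A p) ?TQ w c = w affine_chart"
      by (simp only: TQ Q[OF p] P1_coordinate_vector_simps(1) mult_1_right)
    then show ?thesis
      by (simp add: relative_differential_def TZ coordinate_frame_def mult.assoc)
  qed
  show ?thesis
    unfolding frame_coefficient_def
  proof (rule the_equality)
    show "\<forall>w\<in>tangent_space P1_atlas (Q p). ?R w = (\<lambda>e. D * coordinate_frame Z p w e)"
      using R by blast
  next
    \<comment> \<open>The affine component at the vector with affine component 1 recovers the coefficient.\<close>
    fix g
    assume g: "\<forall>w\<in>tangent_space P1_atlas (Q p). ?R w = (\<lambda>e. g * coordinate_frame Z p w e)"
    have V: "?V (Q p) \<in> tangent_space P1_atlas (Q p)"
      using Q[OF p] P1_coordinate_vector_in_tangent_space by simp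
    have "g * coordinate_frame Z p (?V (Q p)) affine_chart =
        D * coordinate_frame Z p (?V (Q p)) affine_chart"
      using bspec[OF g V] R[OF V] by metis
    then show "g = D"
      using Q[OF p] Z[OF p] by (simp add: coordinate_frame_def P1_coordinate_vector_simps)
  qed
qed

section \<open>The duality identity\<close>

theorem theorem10p1:
  fixes X :: "'a topology" and A :: "'a chart set"
    and U :: "'a set" and q z :: "'a \<Rightarrow> complex"
    and \<zeta> :: "complex \<Rightarrow> complex" and H :: "'a \<Rightarrow> real"
  assumes "riemann_surface X A"
    and "local_coordinate X A (U, q)"
    and "local_coordinate X A (U, z)"
    and "\<zeta> holomorphic_on q ` U"
    and "\<forall>p\<in>U. z p = \<zeta> (q p)"
    and "\<forall>p\<in>U. deriv \<zeta> (q p) \<noteq> 0"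
    and "\<forall>p\<in>U. H p > 0"
    and "\<forall>p\<in>U. H p = cmod (deriv \<zeta> (q p))"
  defines "\<omega> \<equiv> complex_curvature (U, q) H"
    and "\<omega>' \<equiv> complex_curvature (U, z) (\<lambda>p. inverse (H p))"
  shows "(\<forall>p\<in>U. \<forall>v\<in>tangent_space A p.
           1 / of_real (H p) * \<omega>' p * differential A z p v
             - of_real (H p) * \<omega> p * differential A q p v
           = 2 * \<i> * log_differential A (\<lambda>p. deriv \<zeta> (q p)) p v) \<and>
         (\<forall>Q Z :: 'a \<Rightarrow> complex option.
           nonconstant_meromorphic X A Q \<and> nonconstant_meromorphic X A Z \<and>
           (\<forall>p\<in>U. Q p = Some (q p) \<and> Z p = Some (z p)) \<longrightarrow>
           (\<forall>p\<in>U. \<forall>v\<in>tangent_space A p.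
             1 / of_real (H p) * \<omega>' p * differential A z p v
               - of_real (H p) * \<omega> p * differential A q p v
             = 2 * \<i> * maurer_cartan_form A Q (relative_differential A Q Z) (coordinate_frame Z) p v))"
proof -
  note rs = assms(1) and cq = assms(2) and cz = assms(3)
  have charts: "is_chart X (U, q)" "is_chart X (U, z)"
    using cq cz by (auto simp: local_coordinate_def)
  have "open (q ` U)"
    using charts by (simp add: is_chart_def)
  have \<zeta>': "(\<zeta> has_field_derivative deriv \<zeta> (q p)) (at (q p))"
    and \<zeta>'': "(deriv \<zeta> has_field_derivative deriv (deriv \<zeta>) (q p)) (at (q p))"
    if "p \<in> U" for p
    using assms(4) \<open>open (q ` U)\<close> that
    by (auto intro!: holomorphic_derivI[of _ "q ` U"] holomorphic_deriv)
  have "inj_on \<zeta> (q ` U)"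
    using is_chart_inj_on[OF charts(2)] assms(5) by (fastforce simp: inj_on_def)
  then obtain \<eta> where \<eta>: "\<eta> holomorphic_on \<zeta> ` q ` U"
      "\<And>x. x \<in> q ` U \<Longrightarrow> deriv \<zeta> x * deriv \<eta> (\<zeta> x) = 1"
      "\<And>x. x \<in> q ` U \<Longrightarrow> \<eta> (\<zeta> x) = x"
    using holomorphic_has_inverse[OF assms(4) \<open>open (q ` U)\<close>] by metis
  have zU: "\<zeta> ` q ` U = z ` U" "open (z ` U)"
    using assms(5) charts(2) by (auto simp: is_chart_def image_image)
  have identity:
    "1 / of_real (H p) * \<omega>' p * differential A z p v
       - of_real (H p) * \<omega> p * differential A q p v
     = 2 * \<i> * log_differential A (\<lambda>p. deriv \<zeta> (q p)) p v" if p: "p \<in> U" for p v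
  proof -
    define a b where "a = deriv \<zeta> (q p)" and "b = deriv (deriv \<zeta>) (q p)"
    have a: "a \<noteq> 0" "H p \<noteq> 0"
      using assms(6,7) p by (auto simp: a_def)
    have \<omega>: "\<omega> p = - (\<i> / of_real (H p)) * (b / a)"
      using complex_curvature_holomorphic_factor[OF charts(1), of p H "deriv \<zeta>" b] \<zeta>''[OF p] p
        assms(6,8) by (simp add: \<omega>_def a_def b_def)
    have "(\<eta> has_field_derivative inverse a) (at (z p))"
    proof -
      have "deriv \<eta> (z p) = inverse a"
        using \<eta>(2)[of "q p"] p assms(5) by (simp add: a_def inverse_unique)
      then show ?thesis
        using holomorphic_derivI[OF \<eta>(1), of "z p"] zU p by auto
    qed
    moreover have \<eta>z: "\<eta> (z r) = q r" if "r \<in> U" for r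
      using \<eta>(3) assms(5) that by simp
    ultimately have "(deriv \<zeta> \<circ> \<eta> has_field_derivative b * inverse a) (at (z p))"
      using \<zeta>''[OF p] p by (intro DERIV_chain) (auto simp: b_def)
    then have inv: "((\<lambda>w. inverse (deriv \<zeta> (\<eta> w))) has_field_derivative
        - (inverse a * (b * inverse a) * inverse a)) (at (z p))"
      using DERIV_inverse'[of "deriv \<zeta> \<circ> \<eta>" "b * inverse a" "z p" UNIV] a p \<eta>z
      by (simp add: a_def)
    \<comment> \<open>The dual conformal factor is the absolute value of \<open>1 / (\<zeta>' \<circ> \<eta>)\<close>.\<close>
    have \<omega>': "\<omega>' p = \<i> * of_real (H p) * (b / a\<^sup>2)"
    proof -
      have "\<omega>' p = - (\<i> / of_real (inverse (H p))) *
          (- (inverse a * (b * inverse a) * inverse a) / inverse (deriv \<zeta> (\<eta> (snd (U, z) p))))"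
        unfolding \<omega>'_def
      proof (rule complex_curvature_holomorphic_factor[OF charts(2)])
        fix r assume "r \<in> fst (U, z)"
        then show "inverse (H r) = cmod (inverse (deriv \<zeta> (\<eta> (snd (U, z) r))))"
          using \<eta>z assms(8) by (simp add: norm_inverse)
      next
        show "inverse (deriv \<zeta> (\<eta> (snd (U, z) p))) \<noteq> 0"
          using \<eta>z[OF p] a by (simp add: a_def)
      qed (use p inv in simp_all)
      then show ?thesis
        using \<eta>z[OF p] a by (simp add: a_def[symmetric] power2_eq_square divide_inverse)
    qed
    have dz: "differential A z p v = a * differential A q p v"
      using differential_eq[OF rs cq, of p z \<zeta> a] \<zeta>'[OF p] p assms(5) by (simp add: a_def)
    have "differential A (\<lambda>r. deriv \<zeta> (q r)) p v = b * differential A q p v"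
      using differential_eq[OF rs cq, of p "\<lambda>r. deriv \<zeta> (q r)" "deriv \<zeta>" b] \<zeta>''[OF p] p
      by (simp add: b_def)
    then have "log_differential A (\<lambda>p. deriv \<zeta> (q p)) p v = b / a * differential A q p v"
      by (simp add: log_differential_def a_def field_simps)
    then show ?thesis
      using a by (simp add: \<omega> \<omega>' dz power2_eq_square field_simps)
  qed
  have intrinsic:
    "maurer_cartan_form A Q (relative_differential A Q Z) (coordinate_frame Z) p v
     = log_differential A (\<lambda>p. deriv \<zeta> (q p)) p v"
    if QZ: "\<forall>p\<in>U. Q p = Some (q p) \<and> Z p = Some (z p)" and p: "p \<in> U" for Q Z p v
  proof -
    let ?g = "frame_coefficient Q (relative_differential A Q Z) (coordinate_frame Z)"
    have g: "?g r = deriv \<zeta> (q r)" if "r \<in> U" for r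
      using frame_coefficient_relative_differential[OF rs cq, of r Q Z \<zeta>] \<zeta>'[OF that] that QZ
        assms(5) by simp
    \<comment> \<open>The differential only sees values on \<open>U\<close>; off \<open>U\<close> the frame coefficient is unknown.\<close>
    have "differential A f p v = deriv (deriv \<zeta>) (q p) * differential A q p v"
      if "\<And>r. r \<in> U \<Longrightarrow> f r = deriv \<zeta> (q r)" for f
      using differential_eq[OF rs cq, of p f "deriv \<zeta>"] \<zeta>''[OF p] p that by simp
    then show ?thesis
      using g p by (simp add: maurer_cartan_form_def log_differential_def)
  qed
  show ?thesis
  proof (intro conjI ballI allI impI, goal_cases)
    case (1 p v)
    then show ?case
      by (intro identity)
  next
    case (2 Q Z p v)
    then have QZ: "\<forall>p\<in>U. Q p = Some (q p) \<and> Z p = Some (z p)"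
      by blast
    show ?case
      unfolding intrinsic[OF QZ 2(2)] by (rule identity[OF 2(2)])
  qed
qed

end
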